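(* Let $n_\mathcal{G}=n_\mathcal{H}=2$ and $k_\mathcal{G}=k_\mathcal{H}=1$, and let $(\alpha,\beta)$ be any of $(\sqrt2+3,-\sqrt2-2)$, $(-\sqrt2+3,\sqrt2-2)$, $(\sqrt2-3,-\sqrt2+2)$, $(-\sqrt2-3,\sqrt2+2)$. Then for every $(g,h)\in V(\mathcal{G}\square\mathcal{H})$, letting $(g^*,h^* )$ be the only vertex of $V(\mathcal{G}\square\mathcal{H})$ not in $T_{gh}$, the polynomials $s_{g^*h^*}=x_{g^*h^*}$ and $s_1=-\alpha+\alpha\rho^1_{gh}+\beta\rho^2_{gh}$ form a $2$-SOS-certificate of $f_{\text{viz}}$, i.e. $f_{\text{viz}}\equiv s_{g^*h^*}^2+s_1^2\pmod{I_{\text{viz}}}$; consequently Vizing's conjecture holds for these graph classes.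
   Context: Let $\mathbb{K}\subseteq\mathbb{R}$ be a field containing the numbers used. Let $V(\mathcal{G})=\{g_1,\dots,g_{n_\mathcal{G}}\}$, $V(\mathcal{H})=\{h_1,\dots,h_{n_\mathcal{H}}\}$, $V(\mathcal{G}\square\mathcal{H})=V(\mathcal{G})\times V(\mathcal{H})$; $\mathcal{G}$ ($\mathcal{H}$) is the class of graphs on $V(\mathcal{G})$ ($V(\mathcal{H})$) with minimum dominating set $\{g_1\}$ ($\{h_1\}$). Introduce an edge variable $e_{gg'}=e_{g'g}$ for every unordered pair of distinct $g,g'\in V(\mathcal{G})$, an edge variable $e_{hh'}=e_{h'h}$ for every unordered pair of distinct $h,h'\in V(\mathcal{H})$, and a vertex variable $x_{gh}$ for every $(g,h)\in V(\mathcal{G}\square\mathcal{H})$; let $P$ be the polynomial ring over $\mathbb{K}$ in all these variables. For $k_\mathcal{G}=k_\mathcal{H}=1$ the Vizing ideal $I_{\text{viz}}\subseteq P$ is generated by: $e_{gg'}(e_{gg'}-1)$ for all distinct $g,g'\in V(\mathcal{G})$; $1-e_{gg_1}$ for all $g\ne g_1$; $e_{hh'}(e_{hh'}-1)$ for all distinct $h,h'\in V(\mathcal{H})$; $1-e_{hh_1}$ for all $h\neq h_1$; and, for all $(g,h)$, $x_{gh}(x_{gh}-1)$ and $(1-x_{gh})\prod_{g'\ne g}(1-e_{gg'}x_{g'h})\prod_{h'\neq h}(1-e_{hh'}x_{gh'})$. The Vizing polynomial is $f_{\text{viz}}=\big(\sum_{(g,h)}x_{gh}\big)-k_\mathcal{G}k_\mathcal{H}$.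 A polynomial $f$ is $\ell$-SOS modulo $I$ if $f-\sum_i s_i^2\in I$ for some polynomials $s_i$ of degree at most $\ell$ (an SOS-certificate of degree $\ell$); by prior work, $f_{\text{viz}}$ being $\ell$-SOS modulo $I_{\text{viz}}$ implies $\gamma(G\square H)\ge\gamma(G)\gamma(H)$ for all $G\in\mathcal{G}$, $H\in\mathcal{H}$. For $(g,h)$ let $T_{gh}=\{(g',h') : g'=g\text{ or }h'=h\}$ and $\rho^i_{gh}=\sum_{S\subseteq T_{gh},\,|S|=i}\prod_{(g',h')\in S}x_{g'h'}$. *)

theory Defs
  imports
    Complex_Main
    "HOL-Library.Poly_Mapping"
    "HOL-Algebra.Ideal"
    "HOL-Algebra.Subrings"
    "HOL-Algebra.Algebraic_Closure_Type"
begin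

subsection \<open>Polynomial rings\<close>

text \<open>
  Polynomials with real coefficients in variables from the type \<^typ>\<open>'v\<close>: finitely supported
  functions from monomials to coefficients, a monomial being a finitely supported exponent
  function. Multiplication is convolution, so this is a commutative ring.
\<close>

type_synonym 'v mpolynomial = "('v \<Rightarrow>\<^sub>0 nat) \<Rightarrow>\<^sub>0 real"

definition Const :: "real \<Rightarrow> 'v mpolynomial" where
  "Const c = Poly_Mapping.single 0 c"

definition Var :: "'v \<Rightarrow> 'v mpolynomial" where
  "Var v = Poly_Mapping.single (Poly_Mapping.single v 1) 1"

definition total_degree :: "'v mpolynomial \<Rightarrow> nat" where
  "total_degree p =
     Max (insert 0 ((\<lambda>m. \<Sum>v\<in>Poly_Mapping.keys m. Poly_Mapping.lookup m v) ` Poly_Mapping.keys p))"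

text \<open>The polynomial ring \<open>K[W]\<close> for a set \<open>K\<close> of reals and a set \<open>W\<close> of variables.\<close>

definition polynomial_ring :: "real set \<Rightarrow> 'v set \<Rightarrow> 'v mpolynomial ring" where
  "polynomial_ring K W = ring_of_type_algebra
     \<lparr>carrier := {p. range (Poly_Mapping.lookup p) \<subseteq> K \<and>
                     (\<forall>m\<in>Poly_Mapping.keys p. Poly_Mapping.keys m \<subseteq> W)}\<rparr>"

text \<open>The list \<open>ss\<close> is an SOS-certificate of degree \<open>l\<close> of \<open>f\<close> modulo the ideal \<open>I\<close> of \<open>P\<close>.\<close>

definition sos_certificate ::
  "'v mpolynomial ring \<Rightarrow> 'v mpolynomial set \<Rightarrow> nat \<Rightarrow> 'v mpolynomial list \<Rightarrow> 'v mpolynomial \<Rightarrow> bool"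
where
  "sos_certificate P I l ss f \<longleftrightarrow>
     (\<forall>s\<in>set ss. s \<in> carrier P \<and> total_degree s \<le> l) \<and> f - (\<Sum>s\<leftarrow>ss. s ^ 2) \<in> I"


subsection \<open>The Vizing ideal and the Vizing polynomial\<close>

text \<open>Edge variables are indexed by two-element sets, so that \<open>e\<^sub>g\<^sub>g\<^sub>'\<close> and \<open>e\<^sub>g\<^sub>'\<^sub>g\<close> coincide.\<close>

datatype ('a, 'b) viz_var = EdgeG "'a set" | EdgeH "'b set" | Vertex 'a 'b

definition vertex_pairs :: "'a set \<Rightarrow> 'a set set" where
  "vertex_pairs V = {{u, v} | u v. u \<in> V \<and> v \<in> V \<and> u \<noteq> v}"

definition viz_vars :: "'a set \<Rightarrow> 'b set \<Rightarrow> ('a, 'b) viz_var set" where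
  "viz_vars VG VH =
     EdgeG ` vertex_pairs VG \<union> EdgeH ` vertex_pairs VH \<union> {Vertex g h | g h. g \<in> VG \<and> h \<in> VH}"

definition viz_ring :: "real set \<Rightarrow> 'a set \<Rightarrow> 'b set \<Rightarrow> ('a, 'b) viz_var mpolynomial ring" where
  "viz_ring K VG VH = polynomial_ring K (viz_vars VG VH)"

abbreviation eG :: "'a \<Rightarrow> 'a \<Rightarrow> ('a, 'b) viz_var mpolynomial" where
  "eG g g' \<equiv> Var (EdgeG {g, g'})"

abbreviation eH :: "'b \<Rightarrow> 'b \<Rightarrow> ('a, 'b) viz_var mpolynomial" where
  "eH h h' \<equiv> Var (EdgeH {h, h'})"

abbreviation xv :: "'a \<Rightarrow> 'b \<Rightarrow> ('a, 'b) viz_var mpolynomial" where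
  "xv g h \<equiv> Var (Vertex g h)"

text \<open>The generators in the case where the two minimum dominating sets are \<open>{g1}\<close> and \<open>{h1}\<close>.\<close>

definition viz_generators ::
  "'a set \<Rightarrow> 'a \<Rightarrow> 'b set \<Rightarrow> 'b \<Rightarrow> ('a, 'b) viz_var mpolynomial set"
where
  "viz_generators VG g1 VH h1 =
     {eG g g' * (eG g g' - 1) | g g'. g \<in> VG \<and> g' \<in> VG \<and> g \<noteq> g'}
   \<union> {1 - eG g g1 | g. g \<in> VG \<and> g \<noteq> g1}
   \<union> {eH h h' * (eH h h' - 1) | h h'. h \<in> VH \<and> h' \<in> VH \<and> h \<noteq> h'}
   \<union> {1 - eH h h1 | h. h \<in> VH \<and> h \<noteq> h1}
   \<union> {xv g h * (xv g h - 1) | g h. g \<in> VG \<and> h \<in> VH}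
   \<union> {(1 - xv g h) * (\<Prod>g'\<in>VG - {g}. 1 - eG g g' * xv g' h)
                    * (\<Prod>h'\<in>VH - {h}. 1 - eH h h' * xv g h') | g h. g \<in> VG \<and> h \<in> VH}"

definition viz_ideal ::
  "real set \<Rightarrow> 'a set \<Rightarrow> 'a \<Rightarrow> 'b set \<Rightarrow> 'b \<Rightarrow> ('a, 'b) viz_var mpolynomial set"
where
  "viz_ideal K VG g1 VH h1 = Idl\<^bsub>viz_ring K VG VH\<^esub> (viz_generators VG g1 VH h1)"

definition viz_poly :: "'a set \<Rightarrow> 'b set \<Rightarrow> nat \<Rightarrow> nat \<Rightarrow> ('a, 'b) viz_var mpolynomial" where
  "viz_poly VG VH kG kH = (\<Sum>(g, h)\<in>VG \<times> VH. xv g h) - of_nat (kG * kH)"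

definition T_set :: "'a set \<Rightarrow> 'b set \<Rightarrow> 'a \<Rightarrow> 'b \<Rightarrow> ('a \<times> 'b) set" where
  "T_set VG VH g h = {(g', h') \<in> VG \<times> VH. g' = g \<or> h' = h}"

definition rho :: "'a set \<Rightarrow> 'b set \<Rightarrow> nat \<Rightarrow> 'a \<Rightarrow> 'b \<Rightarrow> ('a, 'b) viz_var mpolynomial" where
  "rho VG VH i g h =
     (\<Sum>S | S \<subseteq> T_set VG VH g h \<and> card S = i. \<Prod>(g', h')\<in>S. xv g' h')"


subsection \<open>Graphs and domination\<close>

text \<open>A simple graph is given by its vertex set \<open>V\<close> and its edge set, a subset of
  \<^term>\<open>vertex_pairs V\<close>.\<close>

definition dominating :: "'a set \<Rightarrow> 'a set set \<Rightarrow> 'a set \<Rightarrow> bool" where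
  "dominating V E D \<longleftrightarrow> D \<subseteq> V \<and> (\<forall>v\<in>V - D. \<exists>u\<in>D. {u, v} \<in> E)"

definition domination_number :: "'a set \<Rightarrow> 'a set set \<Rightarrow> nat" where
  "domination_number V E = Min (card ` {D. dominating V E D})"

definition minimum_dominating :: "'a set \<Rightarrow> 'a set set \<Rightarrow> 'a set \<Rightarrow> bool" where
  "minimum_dominating V E D \<longleftrightarrow> dominating V E D \<and> card D = domination_number V E"

definition graph_class :: "'a set \<Rightarrow> 'a set \<Rightarrow> 'a set set set" where
  "graph_class V D = {E. E \<subseteq> vertex_pairs V \<and> minimum_dominating V E D}"

definition box_edges ::
  "'a set \<Rightarrow> 'a set set \<Rightarrow> 'b set \<Rightarrow> 'b set set \<Rightarrow> ('a \<times> 'b) set set"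
where
  "box_edges VG EG VH EH =
     {{(g, h), (g', h')} | g h g' h'. g \<in> VG \<and> g' \<in> VG \<and> h \<in> VH \<and> h' \<in> VH \<and>
        (g = g' \<and> {h, h'} \<in> EH \<or> {g, g'} \<in> EG \<and> h = h')}"


subsection \<open>The Vizing ideal is an ideal\<close>

text \<open>The operator \<open>Idl\<close> is meaningful only for a subset of the carrier of a ring.\<close>

lemma carrier_polynomial_ring:
  "carrier (polynomial_ring K W) =
     {p. range (Poly_Mapping.lookup p) \<subseteq> K \<and> (\<forall>m\<in>Poly_Mapping.keys p. Poly_Mapping.keys m \<subseteq> W)}"
  by (simp add: polynomial_ring_def)

lemma subfield_real_closed:
  assumes "subfield K (ring_of_type_algebra :: real ring)"
  shows "0 \<in> K" "1 \<in> K" "a \<in> K \<Longrightarrow> b \<in> K \<Longrightarrow> a + b \<in> K" "a \<in> K \<Longrightarrow> b \<in> K \<Longrightarrow> a * b \<in> K"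
    "a \<in> K \<Longrightarrow> - a \<in> K"
proof -
  let ?R = "ring_of_type_algebra :: real ring"
  interpret R: ring ?R by (rule ring_from_type_algebra)
  have sr: "subring K ?R"
    using assms by (simp add: subfield.axioms(1) subdomain.axioms(1) subcring.axioms(1))
  have neg: "\<ominus>\<^bsub>?R\<^esub> a = - a" for a
    by (rule R.minus_equality) (auto simp: ring_of_type_algebra_def)
  show "0 \<in> K" "1 \<in> K" "a \<in> K \<Longrightarrow> b \<in> K \<Longrightarrow> a + b \<in> K" "a \<in> K \<Longrightarrow> b \<in> K \<Longrightarrow> a * b \<in> K"
    using subringE(2,3,6,7)[OF sr] by (auto simp: ring_of_type_algebra_def)
  show "a \<in> K \<Longrightarrow> - a \<in> K"
    using subringE(5)[OF sr, of a] by (simp add: neg)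
qed

lemma carrier_iff:
  "p \<in> carrier (polynomial_ring K W) \<longleftrightarrow>
     (\<forall>m. Poly_Mapping.lookup p m \<in> K) \<and> (\<forall>m\<in>Poly_Mapping.keys p. Poly_Mapping.keys m \<subseteq> W)"
  by (auto simp: carrier_polynomial_ring)

lemma carrier_closed:
  assumes "subfield K (ring_of_type_algebra :: real ring)"
  shows "1 \<in> carrier (polynomial_ring K W)"
    and "v \<in> W \<Longrightarrow> Var v \<in> carrier (polynomial_ring K W)"
    and "p \<in> carrier (polynomial_ring K W) \<Longrightarrow> - p \<in> carrier (polynomial_ring K W)"
    and "p \<in> carrier (polynomial_ring K W) \<Longrightarrow> q \<in> carrier (polynomial_ring K W) \<Longrightarrow>
           p + q \<in> carrier (polynomial_ring K W)"
    and "p \<in> carrier (polynomial_ring K W) \<Longrightarrow> q \<in> carrier (polynomial_ring K W) \<Longrightarrow>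
           p - q \<in> carrier (polynomial_ring K W)"
    and "p \<in> carrier (polynomial_ring K W) \<Longrightarrow> q \<in> carrier (polynomial_ring K W) \<Longrightarrow>
           p * q \<in> carrier (polynomial_ring K W)"
proof -
  note K = subfield_real_closed[OF assms]
  show one: "1 \<in> carrier (polynomial_ring K W)"
    using K(1,2) by (auto simp: carrier_iff lookup_one when_def)
  show "v \<in> W \<Longrightarrow> Var v \<in> carrier (polynomial_ring K W)"
    using K(1,2) by (auto simp: carrier_iff Var_def lookup_single when_def)
  show neg: "- p \<in> carrier (polynomial_ring K W)" if "p \<in> carrier (polynomial_ring K W)" for p
    using that K(5) by (auto simp: carrier_iff in_keys_iff)
  show add: "p + q \<in> carrier (polynomial_ring K W)"
    if "p \<in> carrier (polynomial_ring K W)" "q \<in> carrier (polynomial_ring K W)" for p q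
    using that K(3) subsetD[OF keys_add[of p q]] unfolding carrier_iff lookup_add by blast
  show "p \<in> carrier (polynomial_ring K W) \<Longrightarrow> q \<in> carrier (polynomial_ring K W) \<Longrightarrow>
      p - q \<in> carrier (polynomial_ring K W)"
    using add[OF _ neg, of p q] by simp
  have sum: "sum f A \<in> K" if "\<And>x. f x \<in> K" for f :: "'c \<Rightarrow> real" and A
    using that K(1,3) by (induction A rule: infinite_finite_induct) auto
  show "p * q \<in> carrier (polynomial_ring K W)"
    if p: "p \<in> carrier (polynomial_ring K W)" and q: "q \<in> carrier (polynomial_ring K W)"
  proof -
    have pq: "Poly_Mapping.lookup p m \<in> K" "Poly_Mapping.lookup q m \<in> K" for m
      using p q by (auto simp: carrier_iff)
    have "Poly_Mapping.lookup (p * q) m \<in> K" for m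
      unfolding lookup_mult Sum_any.expand_set
      by (intro sum K(4) pq) (simp add: when_def pq K(1))
    moreover have "Poly_Mapping.keys m \<subseteq> W" if m: "m \<in> Poly_Mapping.keys (p * q)" for m
    proof -
      obtain a b where "m = a + b" "a \<in> Poly_Mapping.keys p" "b \<in> Poly_Mapping.keys q"
        using m keys_mult[of p q] by blast
      then show ?thesis
        using p q keys_add[of a b] unfolding carrier_iff by blast
    qed
    ultimately show ?thesis by (auto simp: carrier_iff)
  qed
qed

lemma cring_polynomial_ring:
  assumes "subfield K (ring_of_type_algebra :: real ring)"
  shows "cring (polynomial_ring K W)"
proof -
  let ?R = "ring_of_type_algebra :: 'a mpolynomial ring"
  interpret R: cring ?R by (rule cring_from_type_algebra)
  have neg: "\<ominus>\<^bsub>?R\<^esub> a = - a" for a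
    by (rule R.minus_equality) (auto simp: ring_of_type_algebra_def)
  have "subring (carrier (polynomial_ring K W)) ?R"
    by (rule R.subringI)
       (use carrier_closed[OF assms] in \<open>auto simp: neg\<close>,
        use carrier_closed[OF assms] in \<open>auto simp: ring_of_type_algebra_def\<close>)
  then have "cring (?R\<lparr>carrier := carrier (polynomial_ring K W)\<rparr>)"
    by (intro R.subcring_iff[THEN iffD1] R.subcringI') (auto simp: ring_of_type_algebra_def)
  then show ?thesis by (simp add: polynomial_ring_def)
qed

lemma viz_generators_subset:
  assumes K: "subfield K (ring_of_type_algebra :: real ring)" and "g1 \<in> VG" "h1 \<in> VH"
  shows "viz_generators VG g1 VH h1 \<subseteq> carrier (viz_ring K VG VH)"
proof -
  let ?C = "carrier (polynomial_ring K (viz_vars VG VH))"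
  note var = carrier_closed(2)[OF K, where W = "viz_vars VG VH"]
  note cl = carrier_closed(1,3-6)[OF K, where W = "viz_vars VG VH"]
  have e: "eG g g' \<in> ?C" if "g \<in> VG" "g' \<in> VG" "g \<noteq> g'" for g g'
    using that by (intro var) (unfold viz_vars_def vertex_pairs_def, blast)
  have f: "eH h h' \<in> ?C" if "h \<in> VH" "h' \<in> VH" "h \<noteq> h'" for h h'
    using that by (intro var) (unfold viz_vars_def vertex_pairs_def, blast)
  have x: "xv g h \<in> ?C" if "g \<in> VG" "h \<in> VH" for g h
    using that by (intro var) (auto simp: viz_vars_def)
  have pr: "prod F A \<in> ?C" if "\<And>a. a \<in> A \<Longrightarrow> F a \<in> ?C" for F A
    using that by (induction A rule: infinite_finite_induct) (auto intro: cl)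
  have pr1: "(\<Prod>g'\<in>VG - {g}. 1 - eG g g' * xv g' h) \<in> ?C" if "g \<in> VG" "h \<in> VH" for g h
    using that by (auto intro!: pr cl e x)
  have pr2: "(\<Prod>h'\<in>VH - {h}. 1 - eH h h' * xv g h') \<in> ?C" if "g \<in> VG" "h \<in> VH" for g h
    using that by (auto intro!: pr cl f x)
  show ?thesis
    using assms(2,3) unfolding viz_generators_def viz_ring_def
    by (auto intro!: cl e f x pr1 pr2)
qed

lemma ideal_viz_ideal:
  assumes "subfield K (ring_of_type_algebra :: real ring)" "g1 \<in> VG" "h1 \<in> VH"
  shows "ideal (viz_ideal K VG g1 VH h1) (viz_ring K VG VH)"
proof -
  interpret cring "viz_ring K VG VH"
    unfolding viz_ring_def by (rule cring_polynomial_ring[OF assms(1)])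
  show ?thesis
    unfolding viz_ideal_def by (intro genideal_ideal viz_generators_subset assms)
qed

end

theory Submission
  imports Defs
begin

text \<open>
  Both factors have two vertices, one of which dominates, so all edge variables are 1 modulo the
  Vizing ideal. Write \<open>a\<close>, \<open>b\<close>, \<open>c\<close> for the vertex variables on \<open>T\<^sub>g\<^sub>h\<close> and \<open>d\<close> for the remaining one.
  Modulo the ideal they are Boolean, so \<open>d = d\<^sup>2\<close>, and \<open>(1 - a)(1 - b)(1 - c) = 0\<close>. It remains to see
  that \<open>s\<^sub>1\<^sup>2 = a + b + c - 1\<close> whenever \<open>a + b + c \<in> {1, 2, 3}\<close>; the values of \<open>s\<^sub>1\<close> there are
  \<open>0\<close>, \<open>\<alpha> + \<beta>\<close> and \<open>2\<alpha> + 3\<beta>\<close>, so this amounts to \<open>(\<alpha> + \<beta>)\<^sup>2 = 1\<close> and \<open>(2\<alpha> + 3\<beta>)\<^sup>2 = 2\<close>.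
\<close>

section \<open>Constant polynomials and total degree\<close>

lemma Const_add: "Const (x + y) = Const x + Const y"
  by (simp add: Const_def single_add)

lemma Const_mult: "Const (x * y) = Const x * Const y"
  by (simp add: Const_def mult_single)

lemma Const_1 [simp]: "Const 1 = 1"
  by (simp add: Const_def)

lemma Const_uminus: "Const (- x) = - Const x"
  by (simp add: Const_def single_uminus)

lemma Const_numeral: "Const (numeral n) = numeral n"
  by (induction n) (simp_all only: numeral.simps Const_add Const_1)

lemma Const_in_carrier:
  assumes "subfield K (ring_of_type_algebra :: real ring)" "x \<in> K"
  shows "Const x \<in> carrier (polynomial_ring K W)"
  using assms(2) subfield_real_closed(1)[OF assms(1)]
  by (auto simp: carrier_iff Const_def lookup_single when_def)

definition monomial_degree :: "('v \<Rightarrow>\<^sub>0 nat) \<Rightarrow> nat" where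
  "monomial_degree m = (\<Sum>v\<in>Poly_Mapping.keys m. Poly_Mapping.lookup m v)"

lemma monomial_degree_add: "monomial_degree (m + n) = monomial_degree m + monomial_degree n"
proof -
  let ?A = "Poly_Mapping.keys m \<union> Poly_Mapping.keys n"
  \<comment> \<open>The supports of \<open>m\<close>, \<open>n\<close> and \<open>m + n\<close> may
    differ. Summing over one common superset is harmless because exponents outside a support are
    0.\<close>
  have on_superset: "monomial_degree k = (\<Sum>v\<in>?A. Poly_Mapping.lookup k v)"
    if "Poly_Mapping.keys k \<subseteq> ?A" for k
    unfolding monomial_degree_def
    using that by (intro sum.mono_neutral_left) (auto simp: in_keys_iff)
  show ?thesis
    using on_superset[of m] on_superset[of n] on_superset[of "m + n"] keys_add[of m n]
    by (simp add: lookup_add sum.distrib)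
qed

text \<open>The inserted \<open>0\<close> keeps \<open>Max\<close> defined for the zero polynomial,
  which then satisfies every bound, so degrees can be checked monomial by monomial.\<close>

lemma total_degree_le_iff:
  "total_degree p \<le> n \<longleftrightarrow> (\<forall>m\<in>Poly_Mapping.keys p. monomial_degree m \<le> n)"
  unfolding total_degree_def monomial_degree_def by simp

lemma total_degree_Const: "total_degree (Const x) \<le> n"
  by (auto simp: total_degree_le_iff Const_def monomial_degree_def)

lemma total_degree_Var: "total_degree (Var v) \<le> Suc n"
  by (auto simp: total_degree_le_iff Var_def monomial_degree_def)

lemma total_degree_uminus: "total_degree p \<le> n \<Longrightarrow> total_degree (- p) \<le> n"
  by (auto simp: total_degree_le_iff in_keys_iff)

lemma total_degree_add:
  "total_degree p \<le> n \<Longrightarrow> total_degree q \<le> n \<Longrightarrow> total_degree (p + q) \<le> n"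
  using keys_add[of p q] by (auto simp: total_degree_le_iff)

lemma total_degree_mult:
  assumes "total_degree p \<le> n" "total_degree q \<le> k"
  shows "total_degree (p * q) \<le> n + k"
  unfolding total_degree_le_iff
proof
  fix m assume "m \<in> Poly_Mapping.keys (p * q)"
  then obtain i j where "m = i + j" "i \<in> Poly_Mapping.keys p" "j \<in> Poly_Mapping.keys q"
    using keys_mult[of p q] by blast
  then show "monomial_degree m \<le> n + k"
    using assms by (auto simp: total_degree_le_iff monomial_degree_add intro!: add_mono)
qed

section \<open>The polynomial identity behind the certificate and its coefficients\<close>

text \<open>The cofactors come from reducing \<open>u\<^sup>2\<close>, \<open>u v\<close> and \<open>v\<^sup>2\<close> to multilinear form, where
  \<open>u = a + b + c - 1\<close> and \<open>v = a b + a c + b c\<close>.\<close>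

lemma certificate_identity:
  fixes a b c A B :: "'r::comm_ring_1"
  assumes rel: "A * A + 2 * A * B + B * B = 1" "6 * (A * B + B * B) = - (1 + A * A)"
  defines "cof \<equiv> \<lambda>a b c. A * A + 2 * A * B * (b + c) + B * B * (b * c + b * c)"
  shows "a + b + c - 1 - (- A + A * (a + b + c) + B * (a * b + a * c + b * c)) ^ 2 =
    - (cof a b c + B * B * (b * b + c * c)) * (a * (a - 1))
    - (cof b a c + B * B * (a + c * c)) * (b * (b - 1))
    - (cof c a b + B * B * (a + b)) * (c * (c - 1))
    - (1 + A * A) * ((1 - a) * (1 - b) * (1 - c))"
    (is "?L = ?R")
proof -
  define u v where "u = a + b + c - 1" and "v = a * b + a * c + b * c"
  have uu: "u * u = 1 - (a + b + c) + 2 * v + a * (a - 1) + b * (b - 1) + c * (c - 1)"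
    by (simp add: u_def v_def algebra_simps)
  have uv: "u * v = v + 3 * (a * b * c)
      + (b + c) * (a * (a - 1)) + (a + c) * (b * (b - 1)) + (a + b) * (c * (c - 1))"
    by (simp add: u_def v_def algebra_simps)
  \<comment> \<open>Squares are reduced in the order \<open>a\<close>, \<open>b\<close>,
    \<open>c\<close>, hence the asymmetric terms \<open>b * b + c * c\<close>,
    \<open>a + c * c\<close> and \<open>a + b\<close>.\<close>
  have vv: "v * v = v + 6 * (a * b * c)
      + (b * c + b * c + (b * b + c * c)) * (a * (a - 1))
      + (a * c + a * c + (a + c * c)) * (b * (b - 1))
      + (a * b + a * b + (a + b)) * (c * (c - 1))"
    by (simp add: v_def algebra_simps)
  have dom: "(1 - a) * (1 - b) * (1 - c) = 1 - (a + b + c) + v - a * b * c"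
    by (simp add: v_def algebra_simps)
  have "?L = u - (A * u + B * v) ^ 2"
    by (simp add: u_def v_def algebra_simps)
  also have "\<dots> = u - (A * A * (u * u) + 2 * A * B * (u * v) + B * B * (v * v))"
    by (simp add: power2_eq_square algebra_simps)
  \<comment> \<open>Up to Boolean terms this is \<open>(1 + A * A) * u\<close> plus multiples of
    \<open>v\<close> and \<open>a * b * c\<close>. Trading \<open>u\<close> for the domination
    product by \<open>dom\<close> leaves exactly the two displayed coefficients, which vanish by
    \<open>rel\<close>.\<close>
  also have "\<dots> = ?R + (1 - (A * A + 2 * A * B + B * B)) * v
      - (6 * (A * B + B * B) + (1 + A * A)) * (a * b * c)"
  proof -
    \<comment> \<open>Naming the products stops \<open>algebra_simps\<close> from expanding them;
      both sides have degree one in \<open>p\<close>, \<open>q\<close>, \<open>r\<close>,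
      \<open>v\<close>, \<open>w\<close>.\<close>
    define p q r w where "p = a * (a - 1)" and "q = b * (b - 1)" and "r = c * (c - 1)"
      and "w = a * b * c"
    show ?thesis
      unfolding uu uv vv dom cof_def p_def[symmetric] q_def[symmetric] r_def[symmetric]
        w_def[symmetric]
      by (simp add: u_def algebra_simps)
  qed
  finally show ?thesis
    unfolding rel by simp
qed

text \<open>The second relation is \<open>(2\<alpha> + 3\<beta>)^2 = 2\<close> minus three times
  \<open>(\<alpha> + \<beta>)^2 = 1\<close>. The four pairs differ only in the choice of a root
  \<open>r\<close> of 2 and a global sign \<open>s\<close>, so one computation covers them
  all.\<close>

lemma coefficient_relations:
  fixes \<alpha> \<beta> :: real
  assumes "(\<alpha>, \<beta>) \<in> {(sqrt 2 + 3, - sqrt 2 - 2), (- sqrt 2 + 3, sqrt 2 - 2),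
                     (sqrt 2 - 3, - sqrt 2 + 2), (- sqrt 2 - 3, sqrt 2 + 2)}"
  shows "\<alpha> * \<alpha> + 2 * \<alpha> * \<beta> + \<beta> * \<beta> = 1" and "6 * (\<alpha> * \<beta> + \<beta> * \<beta>) = - (1 + \<alpha> * \<alpha>)"
proof -
  have "\<exists>r s. r * r = 2 \<and> s * s = 1 \<and> \<alpha> = s * (r + 3) \<and> \<beta> = s * (- r - 2)"
  proof -
    have 1: "\<alpha> = 1 * (sqrt 2 + 3) \<and> \<beta> = 1 * (- sqrt 2 - 2) \<or>
        \<alpha> = 1 * (- sqrt 2 + 3) \<and> \<beta> = 1 * (- (- sqrt 2) - 2) \<or>
        \<alpha> = - 1 * (- sqrt 2 + 3) \<and> \<beta> = - 1 * (- (- sqrt 2) - 2) \<or>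
        \<alpha> = - 1 * (sqrt 2 + 3) \<and> \<beta> = - 1 * (- sqrt 2 - 2)"
      using assms by (simp add: add.commute[of "sqrt 2" 2])
    have 2: "sqrt 2 * sqrt 2 = (2 :: real)" "- sqrt 2 * - sqrt 2 = (2 :: real)"
      "1 * 1 = (1 :: real)" "- 1 * - 1 = (1 :: real)"
      by simp_all
    show ?thesis
      using 1 2 by blast
  qed
  then obtain r s where r: "r * r = 2" and s: "s * s = 1"
    and \<alpha>: "\<alpha> = s * (r + 3)" and \<beta>: "\<beta> = s * (- r - 2)"
    by blast
  have "\<alpha> * \<alpha> = (s * s) * (r * r + 6 * r + 9)" "\<alpha> * \<beta> = - (s * s) * (r * r + 5 * r + 6)"
    "\<beta> * \<beta> = (s * s) * (r * r + 4 * r + 4)"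
    by (simp_all add: \<alpha> \<beta> algebra_simps)
  then show "\<alpha> * \<alpha> + 2 * \<alpha> * \<beta> + \<beta> * \<beta> = 1" "6 * (\<alpha> * \<beta> + \<beta> * \<beta>) = - (1 + \<alpha> * \<alpha>)"
    by (simp_all add: r s)
qed

section \<open>\<open>T_set\<close>, \<open>rho\<close> and \<open>viz_poly\<close> for two-vertex
  factors\<close>

lemma T_set_two:
  assumes "g \<noteq> g'" "h \<noteq> h'"
  shows "T_set {g, g'} {h, h'} g h = {(g, h), (g', h), (g, h')}"
  using assms by (auto simp: T_set_def)

lemma rho_1_two:
  assumes "g \<noteq> g'" "h \<noteq> h'"
  shows "rho {g, g'} {h, h'} 1 g h = xv g h + xv g' h + xv g h'"
proof -
  have "{S. S \<subseteq> {(g, h), (g', h), (g, h')} \<and> card S = 1} = {{(g, h)}, {(g', h)}, {(g, h')}}"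
    by (auto simp: card_1_singleton_iff)
  then show ?thesis
    unfolding rho_def T_set_two[OF assms] using assms by (simp add: algebra_simps)
qed

lemma two_subsets_of_three:
  assumes "p \<noteq> q" "p \<noteq> r" "q \<noteq> r"
  shows "{S. S \<subseteq> {p, q, r} \<and> card S = 2} = {{p, q}, {p, r}, {q, r}}"
proof (intro equalityI subsetI)
  fix S assume "S \<in> {S. S \<subseteq> {p, q, r} \<and> card S = 2}"
  then obtain x y where "S = {x, y}" "x \<noteq> y" "x \<in> {p, q, r}" "y \<in> {p, q, r}"
    by (auto simp: card_2_iff)
  then show "S \<in> {{p, q}, {p, r}, {q, r}}"
    by (elim insertE emptyE) (simp_all add: insert_commute)
qed (use assms in auto)

lemma rho_2_two:
  assumes "g \<noteq> g'" "h \<noteq> h'"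
  shows "rho {g, g'} {h, h'} 2 g h = xv g h * xv g' h + xv g h * xv g h' + xv g' h * xv g h'"
proof -
  have "{S. S \<subseteq> {(g, h), (g', h), (g, h')} \<and> card S = 2} =
      {{(g, h), (g', h)}, {(g, h), (g, h')}, {(g', h), (g, h')}}"
    using assms by (intro two_subsets_of_three) auto
  then show ?thesis
    unfolding rho_def T_set_two[OF assms]
    using assms by (simp add: doubleton_eq_iff algebra_simps)
qed

lemma viz_poly_two:
  assumes "g \<noteq> g'" "h \<noteq> h'"
  shows "viz_poly {g, g'} {h, h'} 1 1 = xv g h + xv g' h + xv g h' + xv g' h' - 1"
  using assms by (simp add: viz_poly_def sum.cartesian_product[symmetric] algebra_simps)

section \<open>Membership in the Vizing ideal\<close>

text \<open>Transfers closure from the record operations of the ring to the type-class operations,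
  in which the identities are proved. A difference is handled by multiplying with the ring element
  \<open>- 1\<close>.\<close>

lemma ideal_polynomial_ring_closed:
  assumes K: "subfield K (ring_of_type_algebra :: real ring)" and I: "ideal I (polynomial_ring K W)"
  shows "p \<in> I \<Longrightarrow> q \<in> I \<Longrightarrow> p + q \<in> I"
    and "r \<in> carrier (polynomial_ring K W) \<Longrightarrow> p \<in> I \<Longrightarrow> r * p \<in> I"
    and "p \<in> I \<Longrightarrow> q \<in> I \<Longrightarrow> p - q \<in> I"
proof -
  show add: "p + q \<in> I" if "p \<in> I" "q \<in> I" for p q
    using additive_subgroup.a_closed[OF ideal.axioms(1)[OF I] that]
    by (simp add: polynomial_ring_def ring_of_type_algebra_def)
  show mult: "r * p \<in> I" if "r \<in> carrier (polynomial_ring K W)" "p \<in> I" for r p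
    using ideal.I_l_closed[OF I that(2,1)]
    by (simp add: polynomial_ring_def ring_of_type_algebra_def)
  show "p - q \<in> I" if "p \<in> I" "q \<in> I"
    using add[OF that(1) mult[OF carrier_closed(3)[OF K carrier_closed(1)[OF K]] that(2)]] by simp
qed

lemma viz_certificate_two:
  fixes g g' :: 'a and h h' :: 'b
  assumes K: "subfield K (ring_of_type_algebra :: real ring)" and \<alpha>: "\<alpha> \<in> K" and \<beta>: "\<beta> \<in> K"
    and ne: "g \<noteq> g'" "h \<noteq> h'" and g1: "g1 \<in> {g, g'}" and h1: "h1 \<in> {h, h'}"
    and rel: "\<alpha> * \<alpha> + 2 * \<alpha> * \<beta> + \<beta> * \<beta> = 1" "6 * (\<alpha> * \<beta> + \<beta> * \<beta>) = - (1 + \<alpha> * \<alpha>)"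
  defines "VG \<equiv> {g, g'}" and "VH \<equiv> {h, h'}"
  shows "sos_certificate (viz_ring K VG VH) (viz_ideal K VG g1 VH h1) 2
    [xv g' h', - Const \<alpha> + Const \<alpha> * rho VG VH 1 g h + Const \<beta> * rho VG VH 2 g h]
    (viz_poly VG VH 1 1)"
proof -
  define I where "I = viz_ideal K VG g1 VH h1"
  define C where "C = carrier (polynomial_ring K (viz_vars VG VH))"
  define a b c d :: "('a, 'b) viz_var mpolynomial"
    where "a = xv g h" and "b = xv g' h" and "c = xv g h'" and "d = xv g' h'"
  define e f :: "('a, 'b) viz_var mpolynomial" where "e = eG g g'" and "f = eH h h'"
  define A B :: "('a, 'b) viz_var mpolynomial" where "A = Const \<alpha>" and "B = Const \<beta>"
  define s where "s = - A + A * (a + b + c) + B * (a * b + a * c + b * c)"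
  have g1': "g1 \<in> VG" and h1': "h1 \<in> VH"
    using g1 h1 by (auto simp: VG_def VH_def)
  have I: "ideal I (polynomial_ring K (viz_vars VG VH))"
    using ideal_viz_ideal[OF K g1' h1'] by (simp add: I_def viz_ring_def)
  note Icl = ideal_polynomial_ring_closed[OF K I, folded C_def]
  note Ccl = carrier_closed(1,3-6)[OF K, where W = "viz_vars VG VH", folded C_def]
  have vars: "Var v \<in> C" if "v \<in> viz_vars VG VH" for v
    using carrier_closed(2)[OF K that] by (simp add: C_def)
  have abcd: "a \<in> C" "b \<in> C" "c \<in> C" "d \<in> C"
    unfolding a_def b_def c_def d_def by (auto intro!: vars simp: viz_vars_def VG_def VH_def)
  have ef: "e \<in> C" "f \<in> C"
    unfolding e_def f_def
    by (intro vars; use ne in \<open>unfold viz_vars_def vertex_pairs_def VG_def VH_def, blast\<close>)+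
  have AB: "A \<in> C" "B \<in> C"
    using Const_in_carrier[OF K] \<alpha> \<beta> by (auto simp: A_def B_def C_def)
  have two: "(2 :: ('a, 'b) viz_var mpolynomial) \<in> C"
    using Ccl(3)[OF Ccl(1) Ccl(1)] by simp
  have gens: "p \<in> I" if "p \<in> viz_generators VG g1 VH h1" for p
  proof -
    interpret cring "viz_ring K VG VH"
      unfolding viz_ring_def by (rule cring_polynomial_ring[OF K])
    show ?thesis
      using genideal_self[OF viz_generators_subset[OF K g1' h1']] that
      by (auto simp: I_def viz_ideal_def)
  qed
  have mem: "g \<in> VG" "g' \<in> VG" "h \<in> VH" "h' \<in> VH"
    by (auto simp: VG_def VH_def)
  have "xv u v * (xv u v - 1) \<in> I" if "u \<in> VG" "v \<in> VH" for u v
    using that by (intro gens) (unfold viz_generators_def, blast)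
  then have bool: "x * (x - 1) \<in> I" if "x \<in> {a, b, c, d}" for x
    using that mem unfolding a_def b_def c_def d_def by blast
  have edgeG: "1 - eG u g1 \<in> I" if "u \<in> VG" "u \<noteq> g1" for u
    using that by (intro gens) (unfold viz_generators_def, blast)
  have edgeH: "1 - eH v h1 \<in> I" if "v \<in> VH" "v \<noteq> h1" for v
    using that by (intro gens) (unfold viz_generators_def, blast)
  \<comment> \<open>Each factor has a single possible edge, and it joins the dominating vertex to
    the other one whichever of the two is \<open>g1\<close> or \<open>h1\<close>. So
    \<open>1 - e\<close> and \<open>1 - f\<close> are generators.\<close>
  have "e = eG (if g1 = g then g' else g) g1" "f = eH (if h1 = h then h' else h) h1"
    using g1 h1 by (auto simp: e_def f_def insert_commute)
  then have edge: "1 - e \<in> I" "1 - f \<in> I"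
    using ne mem g1 h1 edgeG edgeH by auto
  have "(1 - a) * (1 - e * b) * (1 - f * c) =
      (1 - xv g h) * (\<Prod>x\<in>VG - {g}. 1 - eG g x * xv x h) * (\<Prod>y\<in>VH - {h}. 1 - eH h y * xv g y)"
    using ne by (simp add: VG_def VH_def insert_Diff_if a_def b_def c_def e_def f_def)
  moreover have "\<dots> \<in> viz_generators VG g1 VH h1"
    using mem unfolding viz_generators_def by blast
  ultimately have dom_edge: "(1 - a) * (1 - e * b) * (1 - f * c) \<in> I"
    by (simp add: gens)
  \<comment> \<open>The edge variables are replaced by 1 one at a time, first \<open>f\<close> and
    then \<open>e\<close>; each replacement costs a multiple of \<open>1 - f\<close> or
    \<open>1 - e\<close>.\<close>
  have "(1 - a) * (1 - b) * (1 - c) = (1 - a) * (1 - e * b) * (1 - f * c)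
      - (1 - a) * (1 - e * b) * c * (1 - f) - (1 - a) * b * (1 - c) * (1 - e)"
    by (simp add: algebra_simps)
  also have "\<dots> \<in> I"
    by (intro dom_edge Icl(3) Icl(2)[OF _ edge(1)] Icl(2)[OF _ edge(2)] Ccl abcd ef)
  finally have dom: "(1 - a) * (1 - b) * (1 - c) \<in> I" .
  have relAB: "A * A + 2 * A * B + B * B = 1" "6 * (A * B + B * B) = - (1 + A * A)"
    using rel[THEN arg_cong[where f = Const]]
    unfolding Const_add Const_mult Const_uminus Const_numeral Const_1 A_def B_def .
  \<comment> \<open>The square of \<open>d\<close> absorbs the summand \<open>d\<close> up to a
    Boolean generator, leaving the left side of \<open>certificate_identity\<close>.\<close>
  have "viz_poly VG VH 1 1 - (d ^ 2 + s ^ 2) = (a + b + c - 1 - s ^ 2) - d * (d - 1)"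
    unfolding VG_def VH_def viz_poly_two[OF ne]
    by (simp add: a_def b_def c_def d_def algebra_simps power2_eq_square)
  also have "\<dots> \<in> I"
    unfolding s_def certificate_identity[OF relAB]
    by (intro Icl(3) Icl(2)[OF _ bool] Icl(2)[OF _ dom] bool Ccl abcd AB two) simp_all
  finally have "viz_poly VG VH 1 1 - (d ^ 2 + s ^ 2) \<in> I" .
  moreover have "s \<in> C"
    unfolding s_def by (intro Ccl abcd AB)
  moreover have deg1: "total_degree x \<le> Suc n" if "x \<in> {a, b, c, d}" for x n
    using that total_degree_Var by (auto simp: a_def b_def c_def d_def)
  \<comment> \<open>The bound 2 is written so that it splits along the products: 0 for the constant
    factor and 1 for each variable of a quadratic term.\<close>
  have "total_degree s \<le> 0 + (1 + 1)"
    unfolding s_def A_def B_def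
    by (intro total_degree_add total_degree_uminus total_degree_mult[where n = 0] total_degree_Const
        total_degree_mult[where n = 1 and k = 1]) (auto intro: deg1)
  moreover have "- Const \<alpha> + Const \<alpha> * rho VG VH 1 g h + Const \<beta> * rho VG VH 2 g h = s"
    unfolding VG_def VH_def rho_1_two[OF ne] rho_2_two[OF ne]
    by (simp add: s_def A_def B_def a_def b_def c_def)
  ultimately show ?thesis
    using abcd(4) deg1[of d 1]
    by (simp add: sos_certificate_def viz_ring_def C_def I_def d_def)
qed

section \<open>Domination numbers\<close>

text \<open>The empty set dominates no vertex, so every dominating set of a nonempty
  \<open>V\<close> is nonempty; finiteness makes \<open>card\<close> and \<open>Min\<close>
  meaningful.\<close>

lemma domination_number_pos:
  assumes "finite V" "V \<noteq> {}"
  shows "1 \<le> domination_number V E"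
proof -
  have fin: "finite {D. dominating V E D}"
    by (rule finite_subset[of _ "Pow V"]) (auto simp: dominating_def assms)
  have "dominating V E V"
    by (simp add: dominating_def)
  moreover have "1 \<le> card D" if "dominating V E D" for D
  proof -
    have "D \<noteq> {}" "finite D"
      using that assms by (auto simp: dominating_def intro: finite_subset)
    then show ?thesis
      by (simp add: Suc_le_eq card_gt_0_iff)
  qed
  ultimately show ?thesis
    unfolding domination_number_def using fin by (subst Min_ge_iff) auto
qed

lemma domination_number_graph_class:
  "E \<in> graph_class V {v} \<Longrightarrow> domination_number V E = 1"
  by (simp add: graph_class_def minimum_dominating_def)

theorem theorem4p3:
  fixes K :: "real set" and VG :: "'a set" and VH :: "'b set"
    and g1 :: 'a and h1 :: 'b and \<alpha> \<beta> :: real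
  assumes "subfield K (ring_of_type_algebra :: real ring)"
    and "\<alpha> \<in> K" and "\<beta> \<in> K"
    and "card VG = 2" and "g1 \<in> VG"
    and "card VH = 2" and "h1 \<in> VH"
    and "(\<alpha>, \<beta>) \<in> {(sqrt 2 + 3, - sqrt 2 - 2), (- sqrt 2 + 3, sqrt 2 - 2),
                   (sqrt 2 - 3, - sqrt 2 + 2), (- sqrt 2 - 3, sqrt 2 + 2)}"
  shows "(\<forall>g\<in>VG. \<forall>h\<in>VH. \<exists>gs hs.
            VG \<times> VH - T_set VG VH g h = {(gs, hs)} \<and>
            sos_certificate (viz_ring K VG VH) (viz_ideal K VG g1 VH h1) 2
              [xv gs hs,
               - Const \<alpha> + Const \<alpha> * rho VG VH 1 g h + Const \<beta> * rho VG VH 2 g h]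
              (viz_poly VG VH 1 1)) \<and>
         (\<forall>EG\<in>graph_class VG {g1}. \<forall>EH\<in>graph_class VH {h1}.
            domination_number (VG \<times> VH) (box_edges VG EG VH EH)
              \<ge> domination_number VG EG * domination_number VH EH)"
proof (intro conjI ballI)
  fix g h assume "g \<in> VG" "h \<in> VH"
  then obtain g' h' where VG: "VG = {g, g'}" "g \<noteq> g'" and VH: "VH = {h, h'}" "h \<noteq> h'"
    using assms(4,6) by (auto simp: card_2_iff)
  have "VG \<times> VH - T_set VG VH g h = {(g', h')}"
    using VG VH by (auto simp: T_set_def)
  moreover note viz_certificate_two[OF assms(1-3) VG(2) VH(2) _ _ coefficient_relations[OF assms(8)]]
  ultimately show "\<exists>gs hs.
      VG \<times> VH - T_set VG VH g h = {(gs, hs)} \<and>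
      sos_certificate (viz_ring K VG VH) (viz_ideal K VG g1 VH h1) 2
        [xv gs hs, - Const \<alpha> + Const \<alpha> * rho VG VH 1 g h + Const \<beta> * rho VG VH 2 g h]
        (viz_poly VG VH 1 1)"
    using assms(5,7) VG(1) VH(1) by blast
next
  \<comment> \<open>Both factors have a one-element minimum dominating set, so the product on the
    left is 1 and positivity on the nonempty product graph suffices.\<close>
  fix EG EH assume "EG \<in> graph_class VG {g1}" "EH \<in> graph_class VH {h1}"
  moreover have "finite (VG \<times> VH)" "VG \<times> VH \<noteq> {}"
    using assms(4-7) card_ge_0_finite[of VG] card_ge_0_finite[of VH] by auto
  ultimately show "domination_number VG EG * domination_number VH EH
      \<le> domination_number (VG \<times> VH) (box_edges VG EG VH EH)"
    using domination_number_pos[of "VG \<times> VH"] by (simp add: domination_number_graph_class)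
qed

end
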